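(* Consider the GPMRT-LB model $$\mathbf m^{n+1}=\mathbf A\,\mathbf m^{n}+\mathbf B\,\mathbf m^{eq,n}+\Delta t\,\mathbf W\tilde{\mathbf F}^{n},\qquad n\in\mathbb N=\{0,1,2,\dots\},$$ with $1\le N\le q$ conservative moments, and let $j\in\{1,\dots,N\}$. Let $I_l$ denote the $l$-th column of $\mathbf I_q$ and put $$\mathbf P_j=\sum_{l\in\{j\}\cup\{N+1,\dots,q\}}I_lI_l^{T},\qquad \tilde{\mathbf A}_j=\mathbf A\mathbf P_j,\qquad \overline{\mathbf A}_j=\mathbf A-\tilde{\mathbf A}_j .$$ Let $\gamma_{j,1},\dots,\gamma_{j,q+2-N}\in\mathcal R$ be the coefficients of the monic characteristic polynomial $p_{\tilde{\mathbf A}_j}(x)=\det(x\mathbf I_q-\tilde{\mathbf A}_j)=\sum_{k=1}^{q+2-N}\gamma_{j,k}\,x^{k+N-2}$ of $\tilde{\mathbf A}_j$. Then the model corresponds to a multiple-level finite-difference scheme on the $j$-th conservative moment $m_j$: for every $n\ge q-N$, $$\begin{aligned} m_j^{n+1}=&-\sum_{k=1}^{q+1-N}\gamma_{j,k}\,m_j^{\,n+N+k-1-q}+\sum_{k=1}^{q+1-N}\Big[\sum_{l=1}^{k}\gamma_{j,q+2-N+l-k}\,\tilde{\mathbf A}_j^{\,l-1}\overline{\mathbf A}_j\mathbf m^{n-k+1}\Big]_j\\ &+\sum_{k=1}^{q+1-N}\Big[\sum_{l=1}^{k}\gamma_{j,q+2-N+l-k}\,\tilde{\mathbf A}_j^{\,l-1}\big(\mathbf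 B\,\mathbf m^{eq,n-k+1}+\Delta t\,\mathbf W\tilde{\mathbf F}^{n-k+1}\big)\Big]_j,\end{aligned}$$ or, in an alternative form, for every $n\in\mathbb N$, $$\det\big(T^1_{\Delta t}\mathbf I_q-\tilde{\mathbf A}_j\big)m_j^n=\Big[\mathrm{adj}\big(T^1_{\Delta t}\mathbf I_q-\tilde{\mathbf A}_j\big)\overline{\mathbf A}_j\mathbf m^n\Big]_j+\Big[\mathrm{adj}\big(T^1_{\Delta t}\mathbf I_q-\tilde{\mathbf A}_j\big)\big(\mathbf B\,\mathbf m^{eq,n}+\Delta t\,\mathbf W\tilde{\mathbf F}^n\big)\Big]_j .$$
   Context: Lattice and operators. Let $d\in\{1,2,3\}$, $q\ge 1$, $\Delta x,\Delta t>0$, $\mathcal L=\Delta x\,\mathbb Z^d$. For $\mathbf z\in\mathbb Z^d$ the space shift is $(T^{\mathbf z}_{\Delta x}h)(\mathbf x)=h(\mathbf x+\mathbf z\Delta x)$ for $h:\mathcal L\to\mathbb R$. Let $\mathcal R$ be the commutative ring of operators generated over $\mathbb R$ by all space shifts. For sequences $(h^n)_{n\in\mathbb N}$ of functions on $\mathcal L$ the time shift is $T^1_{\Delta t}h^n=h^{n+1}$; it commutes with $\mathcal R$, and determinants and adjugates (denoted $\mathrm{adj}$) of matrices over $\mathcal R[T^1_{\Delta t}]$ are taken in this commutative ring. Matrices over this ring act on vector-valued sequences in the obvious way; $[\cdot]_j$ denotes the $j$-th component. Model data. $\mathbf e_1,\dots,\mathbf e_q\in\mathbb Z^d$ are the discrete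 velocity directions; $a,b\in\mathbb R$ with $0<a\le1$, $a^2\le b\le 1$; $p_0=1-b$, $p_{-1}=\frac{a+b}{2}$, $p_1=\frac{b-a}{2}$. $\mathbf M$ (transform matrix) and $\mathbf S$ (relaxation matrix) are real invertible $q\times q$ matrices, independent of space and time. Put $$\overline{\mathbf T}=p_0\mathbf I_q+p_{-1}\,\mathrm{diag}(T^{-\mathbf e_1}_{\Delta x},\dots,T^{-\mathbf e_q}_{\Delta x})+p_1\,\mathrm{diag}(T^{\mathbf e_1}_{\Delta x},\dots,T^{\mathbf e_q}_{\Delta x}),$$ $$\mathbf W=\mathbf M\overline{\mathbf T}\mathbf M^{-1},\quad \mathbf A=\mathbf W(\mathbf I_q-\mathbf S),\quad \mathbf B=\mathbf W\mathbf S .$$ $\mathbf m^n,\mathbf m^{eq,n},\tilde{\mathbf F}^n:\mathcal L\to\mathbb R^q$ are the moments, equilibrium moments and source/force moments at time $n\Delta t$; $\mathbf m^{eq,n}$ and $\tilde{\mathbf F}^n$ are treated as given sequences. The first $N$ moments are conservative: $m_l^{eq,n}=m_l^n$ for $1\le l\le N$. *)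

theory Defs
  imports "HOL-Analysis.Finite_Cartesian_Product" "HOL-Library.Product_Plus"
    "Jordan_Normal_Form.Char_Poly"
begin

definition shift_fun :: "'g::comm_monoid_add \<Rightarrow> ('g \<Rightarrow> real) \<Rightarrow> 'g \<Rightarrow> real" where
  "shift_fun v h x = h (x + v)"

inductive_set shift_algebra :: "(('g::comm_monoid_add \<Rightarrow> real) \<Rightarrow> 'g \<Rightarrow> real) set" where
  shift: "shift_fun v \<in> shift_algebra"
| scale: "P \<in> shift_algebra \<Longrightarrow> (\<lambda>h x. c * P h x) \<in> shift_algebra"
| add: "P \<in> shift_algebra \<Longrightarrow> Q \<in> shift_algebra \<Longrightarrow> (\<lambda>h x. P h x + Q h x) \<in> shift_algebra"
| comp: "P \<in> shift_algebra \<Longrightarrow> Q \<in> shift_algebra \<Longrightarrow> (\<lambda>h. P (Q h)) \<in> shift_algebra"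

lemma shift_algebra_add:
  assumes "P \<in> shift_algebra"
  shows "P (\<lambda>x. h x + k x) = (\<lambda>x. P h x + P k x)"
  using assms
  by (induction arbitrary: h k rule: shift_algebra.induct)
     (simp_all add: shift_fun_def[abs_def] algebra_simps)

lemma shift_algebra_scale:
  assumes "P \<in> shift_algebra"
  shows "P (\<lambda>x. c * h x) = (\<lambda>x. c * P h x)"
  using assms
  by (induction arbitrary: h rule: shift_algebra.induct)
     (simp_all add: shift_fun_def[abs_def] algebra_simps)

lemma shift_algebra_commute_shift:
  assumes "P \<in> shift_algebra"
  shows "P (shift_fun v h) = shift_fun v (P h)"
  using assms
proof (induction arbitrary: h rule: shift_algebra.induct)
  case (shift w)
  show ?case by (simp add: shift_fun_def fun_eq_iff add.assoc add.commute[of v])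
qed (simp_all add: shift_fun_def[of v, abs_def])

lemma shift_algebra_commute:
  assumes "P \<in> shift_algebra" "Q \<in> shift_algebra"
  shows "P (Q h) = Q (P h)"
  using assms
  by (induction arbitrary: h rule: shift_algebra.induct)
     (simp_all add: shift_algebra_commute_shift shift_algebra_add shift_algebra_scale)

lemma shift_algebra_id: "(\<lambda>h. h) \<in> shift_algebra"
  using shift_algebra.shift[of 0] by (simp add: shift_fun_def[abs_def])

lemma shift_algebra_zero: "(\<lambda>h x. 0) \<in> shift_algebra"
  using shift_algebra.scale[OF shift_algebra_id, of 0] by simp

lemma shift_algebra_uminus: "P \<in> shift_algebra \<Longrightarrow> (\<lambda>h x. - P h x) \<in> shift_algebra"
  using shift_algebra.scale[of P "-1"] by simp

lemma shift_algebra_minus: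
  "P \<in> shift_algebra \<Longrightarrow> Q \<in> shift_algebra \<Longrightarrow> (\<lambda>h x. P h x - Q h x) \<in> shift_algebra"
  using shift_algebra.add[of P "\<lambda>h x. - Q h x"] shift_algebra_uminus[of Q] by simp

typedef (overloaded) ('g::comm_monoid_add) shift_op =
    "shift_algebra :: (('g \<Rightarrow> real) \<Rightarrow> 'g \<Rightarrow> real) set"
  morphisms app Abs_shift_op
  using shift_algebra_id by blast

setup_lifting type_definition_shift_op

instantiation shift_op :: (comm_monoid_add) "{comm_ring_1, real_algebra_1}"
begin

lift_definition zero_shift_op :: "'a shift_op" is "\<lambda>h x. 0" by (rule shift_algebra_zero)
lift_definition one_shift_op :: "'a shift_op" is "\<lambda>h. h" by (rule shift_algebra_id)
lift_definition plus_shift_op :: "'a shift_op \<Rightarrow> 'a shift_op \<Rightarrow> 'a shift_op"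
  is "\<lambda>P Q h x. P h x + Q h x" by (rule shift_algebra.add)
lift_definition minus_shift_op :: "'a shift_op \<Rightarrow> 'a shift_op \<Rightarrow> 'a shift_op"
  is "\<lambda>P Q h x. P h x - Q h x" by (rule shift_algebra_minus)
lift_definition uminus_shift_op :: "'a shift_op \<Rightarrow> 'a shift_op"
  is "\<lambda>P h x. - P h x" by (rule shift_algebra_uminus)
lift_definition times_shift_op :: "'a shift_op \<Rightarrow> 'a shift_op \<Rightarrow> 'a shift_op"
  is "\<lambda>P Q h. P (Q h)" by (rule shift_algebra.comp)
lift_definition scaleR_shift_op :: "real \<Rightarrow> 'a shift_op \<Rightarrow> 'a shift_op"
  is "\<lambda>c P h x. c * P h x" by (rule shift_algebra.scale)

instance
proof
  fix P Q R :: "'a shift_op" and c d :: real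
  show "(0::'a shift_op) \<noteq> 1"
    by transfer (metis zero_neq_one)
  show "P * Q = Q * P"
    by transfer (intro ext, simp add: shift_algebra_commute)
  show "P * 1 = P"
    by transfer simp
  show "P * (Q + R) = P * Q + P * R"
    by transfer (simp add: shift_algebra_add)
  show "(P * Q) * R = P * (Q * R)" "1 * P = P"
    "(P + Q) * R = P * R + Q * R" "c *\<^sub>R P * Q = c *\<^sub>R (P * Q)"
    "(P + Q) + R = P + (Q + R)" "P + Q = Q + P" "0 + P = P" "- P + P = 0" "P - Q = P + - Q"
    "c *\<^sub>R (P + Q) = c *\<^sub>R P + c *\<^sub>R Q" "(c + d) *\<^sub>R P = c *\<^sub>R P + d *\<^sub>R P"
    "c *\<^sub>R d *\<^sub>R P = (c * d) *\<^sub>R P" "1 *\<^sub>R P = P"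
    by (transfer; simp add: algebra_simps)+
  show "P * c *\<^sub>R Q = c *\<^sub>R (P * Q)"
    by transfer (simp add: shift_algebra_scale)
qed

end

lift_definition shift :: "'g::comm_monoid_add \<Rightarrow> 'g shift_op" is shift_fun
  by (rule shift_algebra.shift)

text \<open>
  A function \<open>h\<close> on the lattice with spacing \<open>dx\<close> is a function on \<open>int^'d\<close>, the value at \<open>z\<close>
  being \<open>h (dx *\<^sub>R z)\<close>; the operators on such functions generated by the space shifts form the
  ring \<open>(int^'d) shift_op\<close>.  A sequence of such functions is a function on \<open>nat \<times> (int^'d)\<close>, and
  \<open>(nat \<times> (int^'d)) shift_op\<close> is the ring generated by the space shifts and the time shift.
\<close>

lemma lift_time_shift_algebra:
  assumes "P \<in> shift_algebra"
  shows "(\<lambda>h (n::nat, x). P (\<lambda>y. h (n, y)) x) \<in> shift_algebra"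
  using assms
proof (induction rule: shift_algebra.induct)
  case (shift v)
  have "(\<lambda>h (n::nat, x). shift_fun v (\<lambda>y. h (n, y)) x) = shift_fun (0, v)"
    by (auto simp: fun_eq_iff shift_fun_def)
  then show ?case by (metis shift_algebra.shift)
next
  case (scale P c)
  from shift_algebra.scale[OF this(2), of c] show ?case by (simp add: case_prod_beta')
next
  case (add P Q)
  from shift_algebra.add[OF this(3,4)] show ?case by (simp add: case_prod_beta')
next
  case (comp P Q)
  from shift_algebra.comp[OF this(3,4)] show ?case by (simp add: case_prod_beta')
qed

text \<open>The inclusion of the space operators into the space-time operators.\<close>

lift_definition space_op :: "'g::comm_monoid_add shift_op \<Rightarrow> (nat \<times> 'g) shift_op"
  is "\<lambda>P h (n, x). P (\<lambda>y. h (n, y)) x"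
  by (rule lift_time_shift_algebra)

definition time_shift :: "(nat \<times> 'g::comm_monoid_add) shift_op" where
  "time_shift = shift (1, 0)"

lemma app_time_shift: "app time_shift h (n, x) = h (n + 1, x)"
  by (simp add: time_shift_def shift.rep_eq shift_fun_def)

text \<open>Vector-valued functions are families of components, indexed from \<open>0\<close>.\<close>

definition mat_app :: "'g::comm_monoid_add shift_op mat \<Rightarrow> (nat \<Rightarrow> 'g \<Rightarrow> real) \<Rightarrow> nat \<Rightarrow> 'g \<Rightarrow> real" where
  "mat_app A u i x = (\<Sum>c<dim_col A. app (A $$ (i, c)) (u c) x)"

definition lattice_point :: "real \<Rightarrow> int^'d \<Rightarrow> real^'d" where
  "lattice_point dx z = (\<chi> k. dx * real_of_int (vec_nth z k))"

text \<open>The restrictions to the lattice of one time level, and of all time levels, of \<open>u\<close>.\<close>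

definition level :: "real \<Rightarrow> (nat \<Rightarrow> nat \<Rightarrow> real^'d \<Rightarrow> real) \<Rightarrow> nat \<Rightarrow> nat \<Rightarrow> int^'d \<Rightarrow> real" where
  "level dx u n i z = u n i (lattice_point dx z)"

definition levels :: "real \<Rightarrow> (nat \<Rightarrow> nat \<Rightarrow> real^'d \<Rightarrow> real) \<Rightarrow> nat \<Rightarrow> nat \<times> (int^'d) \<Rightarrow> real" where
  "levels dx u i = (\<lambda>(n, z). level dx u n i z)"

lemma app_shift_level:
  "app (shift v) (level dx u n i) z = u n i (lattice_point dx z + lattice_point dx v)"
proof -
  have "lattice_point dx (z + v) = lattice_point dx z + lattice_point dx v"
    by (simp add: lattice_point_def Finite_Cartesian_Product.vec_eq_iff distrib_left)
  then show ?thesis by (simp add: shift.rep_eq shift_fun_def level_def)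
qed

text \<open>The sum of \<open>I\<^sub>l I\<^sub>l\<^sup>T\<close> over \<open>l \<in> L\<close>, with \<open>I\<^sub>l\<close> the columns of the identity matrix.\<close>

definition select_mat :: "nat \<Rightarrow> nat set \<Rightarrow> 'a::comm_ring_1 mat" where
  "select_mat q L = Matrix.mat q q (\<lambda>(r, c). \<Sum>l\<in>L. unit_vec q l $ r * unit_vec q l $ c)"

end

theory Submission
  imports Defs
begin

text \<open>
  The model says that \<open>m\<close> obeys \<open>m\<^sup>n\<^sup>+\<^sup>1 = At m\<^sup>n + s\<^sup>n\<close>, where \<open>s\<^sup>n\<close> collects all other terms.  Applying
  \<open>adj (T I - At)\<close> to this identity gives the determinant form.  For the explicit form, unroll the
  recurrence from time \<open>n + N - q\<close> and combine the levels with the coefficients \<open>\<gamma>\<close>: the powers of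
  \<open>At\<close> acting on the initial level cancel in row \<open>j\<close>.  Cayley-Hamilton alone would yield only the
  weaker cancellation with \<open>N - 1\<close> further powers of \<open>At\<close>; the sharper one uses that the
  \<open>N - 1\<close> columns of \<open>At\<close> of the other conserved moments vanish.
\<close>

section \<open>Linearity of shift operators and of matrices of them\<close>

lemma app_add: "app P (\<lambda>x. h x + k x) x = app P h x + app P k x"
  by (simp add: shift_algebra_add[OF app])

lemma app_scale: "app P (\<lambda>x. c * h x) x = c * app P h x"
  by (simp add: shift_algebra_scale[OF app])

lemma app_sum: "app P (\<lambda>x. \<Sum>i\<in>I. h i x) x = (\<Sum>i\<in>I. app P (h i) x)"
proof (induction I rule: infinite_finite_induct)
  case (insert i I)
  then show ?case by (simp add: app_add)
\<comment> \<open>Scaling by 0 shows that \<open>P\<close> maps the zero function to itself, which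
  settles empty and infinite index sets.\<close>
qed (use app_scale[of P 0 "\<lambda>x. 0" x] in simp_all)

lemma app_sum_op: "app (\<Sum>i\<in>I. P i) h x = (\<Sum>i\<in>I. app (P i) h x)"
  by (induction I rule: infinite_finite_induct)
     (simp_all add: zero_shift_op.rep_eq plus_shift_op.rep_eq)

lemma mat_app_cong:
  assumes "\<And>c. c < dim_col A \<Longrightarrow> u c = v c"
  shows "mat_app A u i x = mat_app A v i x"
  unfolding mat_app_def using assms by (intro sum.cong) auto

lemma mat_app_add: "mat_app A (\<lambda>i y. u i y + v i y) i x = mat_app A u i x + mat_app A v i x"
  by (simp add: mat_app_def app_add sum.distrib)

text \<open>The ring product is composition, so additivity of each entry of \<open>A\<close> and an
  exchange of finite sums suffice.\<close>

lemma mat_app_mult: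
  assumes "A \<in> carrier_mat n k" "B \<in> carrier_mat k l" "i < n"
  shows "mat_app (A * B) u i x = mat_app A (mat_app B u) i x"
proof -
  have "mat_app (A * B) u i x = (\<Sum>c<l. \<Sum>b<k. app (A $$ (i, b)) (app (B $$ (b, c)) (u c)) x)"
    using assms by (simp add: mat_app_def scalar_prod_def app_sum_op times_shift_op.rep_eq
        atLeast0LessThan)
  also have "\<dots> = (\<Sum>b<k. \<Sum>c<l. app (A $$ (i, b)) (app (B $$ (b, c)) (u c)) x)"
    by (rule sum.swap)
  also have "\<dots> = mat_app A (mat_app B u) i x"
    using assms by (simp add: mat_app_def[abs_def] app_sum)
  finally show ?thesis .
qed

lemma mat_app_minus:
  assumes "A \<in> carrier_mat n k" "B \<in> carrier_mat n k" "i < n"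
  shows "mat_app (A - B) u i x = mat_app A u i x - mat_app B u i x"
  using assms by (simp add: mat_app_def minus_shift_op.rep_eq sum_subtractf)

lemma mat_app_smult:
  assumes "i < dim_row A"
  shows "mat_app (c \<cdot>\<^sub>m A) u i x = app c (mat_app A u i) x"
  using assms by (simp add: mat_app_def[abs_def] times_shift_op.rep_eq app_sum)

lemma mat_app_one:
  assumes "i < n"
  shows "mat_app (1\<^sub>m n) u i = u i"
proof
  fix x
  have "mat_app (1\<^sub>m n) u i x = (\<Sum>c<n. if i = c then u c x else 0)"
    unfolding mat_app_def using assms
    by (intro sum.cong) (auto simp: one_shift_op.rep_eq zero_shift_op.rep_eq)
  then show "mat_app (1\<^sub>m n) u i x = u i x" using assms by simp
qed

text \<open>Space operators never mix time levels; this connects the space-time form of the model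
  with the levelwise one.\<close>

lemma mat_app_space_op:
  assumes "i < dim_row A"
  shows "mat_app (map_mat space_op A) (levels dx u) i (n, z) = mat_app A (level dx u n) i z"
  using assms by (simp add: mat_app_def space_op.rep_eq levels_def)

section \<open>Matrix powers and linear recurrences\<close>

lemma pow_mat_Suc_left:
  assumes "A \<in> carrier_mat n n"
  shows "A ^\<^sub>m Suc k = A * A ^\<^sub>m k"
  using assms by (induction k) (simp_all add: assoc_mult_mat[OF _ pow_carrier_mat])

text \<open>Discrete Duhamel formula: a source entering at step \<open>n + t\<close> is propagated
  through the remaining \<open>k - 1 - t\<close> steps.\<close>

lemma recurrence_unroll:
  fixes u s :: "nat \<Rightarrow> nat \<Rightarrow> 'g::comm_monoid_add \<Rightarrow> real"
  assumes A: "A \<in> carrier_mat q q"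
    and step: "\<And>n i x. i < q \<Longrightarrow> u (Suc n) i x = mat_app A (u n) i x + s n i x"
    and i: "i < q"
  shows "u (n + k) i x =
    mat_app (A ^\<^sub>m k) (u n) i x + (\<Sum>t<k. mat_app (A ^\<^sub>m (k - 1 - t)) (s (n + t)) i x)"
\<comment> \<open>The first step is peeled off, not the last, so \<open>n\<close> must vary;
  \<open>s n\<close> becomes the summand \<open>t = 0\<close>.\<close>
proof (induction k arbitrary: n)
  case 0
  show ?case using A i by (simp add: mat_app_one)
next
  case (Suc k)
  have "mat_app (A ^\<^sub>m k) (u (Suc n)) i x
      = mat_app (A ^\<^sub>m k) (\<lambda>i x. mat_app A (u n) i x + s n i x) i x"
    using step pow_carrier_mat[OF A, of k] by (intro mat_app_cong) (auto simp: fun_eq_iff)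
  also have "\<dots> = mat_app (A ^\<^sub>m Suc k) (u n) i x + mat_app (A ^\<^sub>m k) (s n) i x"
    using A i by (simp add: mat_app_add mat_app_mult[OF pow_carrier_mat])
  finally show ?case
    using Suc.IH[of "Suc n"] by (simp add: sum.lessThan_Suc_shift del: sum.lessThan_Suc)
qed

text \<open>Weighting the unrolled levels by \<open>c k\<close> applies
  \<open>\<Sum>k\<le>r. c k * A ^ k\<close> to the initial level \<open>u n\<close>. Only component
  \<open>j\<close> is read, so it is enough that row \<open>j\<close> of this matrix
  vanishes.\<close>

lemma annihilated_recurrence:
  fixes u s :: "nat \<Rightarrow> nat \<Rightarrow> 'g::comm_monoid_add \<Rightarrow> real"
  assumes A: "A \<in> carrier_mat q q"
    and step: "\<And>n i x. i < q \<Longrightarrow> u (Suc n) i x = mat_app A (u n) i x + s n i x"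
    and j: "j < q"
    and zero: "\<And>i. i < q \<Longrightarrow> (\<Sum>k\<le>r. c k * (A ^\<^sub>m k) $$ (j, i)) = 0"
  shows "(\<Sum>k\<le>r. app (c k) (u (n + k) j) x) =
    (\<Sum>k\<le>r. \<Sum>t<k. mat_app (c k \<cdot>\<^sub>m A ^\<^sub>m (k - 1 - t)) (s (n + t)) j x)"
proof -
  have dims: "dim_row (A ^\<^sub>m k) = q" "dim_col (A ^\<^sub>m k) = q" for k
    using pow_carrier_mat[OF A, of k] by auto
  have "(\<Sum>k\<le>r. mat_app (c k \<cdot>\<^sub>m A ^\<^sub>m k) (u n) j x)
      = (\<Sum>k\<le>r. \<Sum>i<q. app (c k * (A ^\<^sub>m k) $$ (j, i)) (u n i) x)"
    using j by (simp add: mat_app_def dims del: pow_mat_dim)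
  also have "\<dots> = (\<Sum>i<q. app (\<Sum>k\<le>r. c k * (A ^\<^sub>m k) $$ (j, i)) (u n i) x)"
    by (subst sum.swap) (simp only: app_sum_op)
  also have "\<dots> = 0"
    by (simp add: zero zero_shift_op.rep_eq)
  finally have "(\<Sum>k\<le>r. mat_app (c k \<cdot>\<^sub>m A ^\<^sub>m k) (u n) j x) = 0" .
  moreover have "app (c k) (u (n + k) j) x = mat_app (c k \<cdot>\<^sub>m A ^\<^sub>m k) (u n) j x
      + (\<Sum>t<k. mat_app (c k \<cdot>\<^sub>m A ^\<^sub>m (k - 1 - t)) (s (n + t)) j x)" for k
  proof -
    have "u (n + k) j = (\<lambda>x. mat_app (A ^\<^sub>m k) (u n) j x
        + (\<Sum>t<k. mat_app (A ^\<^sub>m (k - 1 - t)) (s (n + t)) j x))"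
      using recurrence_unroll[where u = u and s = s, OF A step j] by (intro ext) blast
    then show ?thesis
      using j by (simp only: app_add app_sum mat_app_smult dims)
  qed
  ultimately show ?thesis
    by (simp add: sum.distrib)
qed

section \<open>A Cayley-Hamilton identity for rows, sharpened by zero columns\<close>

text \<open>
  Pulling the factor \<open>x\<close> out of the columns of \<open>x I - A\<close> indexed by \<open>Z\<close> leaves a matrix \<open>D\<close>;
  row \<open>j\<close> of \<open>adj D\<close> is a left quotient of \<open>det D\<close> times the \<open>j\<close>-th unit row by \<open>x I - A\<close>, which
  gives row \<open>j\<close> of the Cayley-Hamilton identity for \<open>det D\<close> in place of \<open>char_poly A\<close>.
\<close>

lemma char_poly_zero_columns:
  fixes A :: "'a::comm_ring_1 mat"
  assumes A: "A \<in> carrier_mat n n" and Z: "Z \<subseteq> {..<n}"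
    and zero: "\<And>i c. i < n \<Longrightarrow> c \<in> Z \<Longrightarrow> A $$ (i, c) = 0"
  obtains p where "char_poly A = Polynomial.monom 1 (card Z) * p"
    and "\<And>j c. j < n \<Longrightarrow> j \<notin> Z \<Longrightarrow> c < n \<Longrightarrow>
      (\<Sum>k\<le>degree p. poly.coeff p k * (A ^\<^sub>m k) $$ (j, c)) = 0"
proof -
  let ?X = "Polynomial.monom 1 1 :: 'a poly"
  define E where "E = mat_diag n (\<lambda>i. if i \<in> Z then ?X else 1)"
  \<comment> \<open>A column of \<open>x I - A\<close> indexed by \<open>Z\<close> is
    \<open>x\<close> times a unit column; \<open>E\<close> carries that \<open>x\<close>,
    \<open>D\<close> keeps the unit column.\<close>
  define D where "D = Matrix.mat n n (\<lambda>(i, c). if c \<in> Z then if i = c then 1 else 0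
      else char_poly_matrix A $$ (i, c))"
  define p where "p = Determinant.det D"
  have D: "D \<in> carrier_mat n n" and E: "E \<in> carrier_mat n n"
    by (simp_all add: D_def E_def)
  have entry: "char_poly_matrix A $$ (i, c) = (if i = c then ?X else 0) - [:A $$ (i, c):]"
    if "i < n" "c < n" for i c
    using A that by (auto simp: char_poly_matrix_def monom_altdef)
  have DE: "char_poly_matrix A = D * E"
    unfolding E_def mat_diag_mult_right[OF D]
    using A by (intro eq_matI) (auto simp: D_def entry zero char_poly_matrix_def[of A] monom_altdef)
  have "Determinant.det E = prod_list (diag_mat E)"
    by (rule det_upper_triangular[OF _ E]) (auto simp: E_def upper_triangular_def mat_diag_def)
  also have "\<dots> = (\<Prod>i<n. if i \<in> Z then ?X else 1)"
    unfolding prod_list_diag_prod by (auto simp: E_def mat_diag_def atLeast0LessThan intro!: prod.cong)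
  also have "\<dots> = ?X ^ card Z"
    using Z by (simp add: prod.If_cases Int_absorb1)
  finally have "Determinant.det E = Polynomial.monom 1 (card Z)"
    by (simp only: x_pow_n)
  then have char: "char_poly A = Polynomial.monom 1 (card Z) * p"
    by (simp add: char_poly_def DE det_mult[OF D E] p_def mult.commute)
  show thesis
  proof (rule that[OF char])
    fix j c assume j: "j < n" "j \<notin> Z" and c: "c < n"
    define R where "R b = adj_mat D $$ (j, b)" for b
    have adj: "adj_mat D \<in> carrier_mat n n" "adj_mat D * D = p \<cdot>\<^sub>m 1\<^sub>m n"
      using adj_mat[OF D] by (simp_all add: p_def)
    \<comment> \<open>This is row \<open>j\<close> of \<open>adj D * D * E = p E\<close>; since
      \<open>j \<notin> Z\<close>, the diagonal entry of \<open>E\<close> there is 1 and not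
      \<open>x\<close>.\<close>
    have RD: "(\<Sum>b<n. R b * char_poly_matrix A $$ (b, c)) = (if c = j then p else 0)"
      if c: "c < n" for c
    proof -
      have "(\<Sum>b<n. R b * char_poly_matrix A $$ (b, c)) = (adj_mat D * (D * E)) $$ (j, c)"
        using adj char_poly_matrix_closed[OF A] c j
        by (simp add: R_def scalar_prod_def atLeast0LessThan flip: DE)
      also have "adj_mat D * (D * E) = p \<cdot>\<^sub>m E"
        using adj D E by (simp add: mult_smult_assoc_mat[of _ n n] flip: assoc_mult_mat)
      also have "(p \<cdot>\<^sub>m E) $$ (j, c) = (if c = j then p else 0)"
        using j c by (simp add: E_def mat_diag_def)
      finally show ?thesis .
    qed
    \<comment> \<open>The extra factor \<open>x\<close> makes \<open>?r (Suc k) b\<close> the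
      coefficient \<open>k\<close> of \<open>R b\<close> and \<open>?r 0 b\<close> zero, so
      comparing coefficients in \<open>RD\<close> needs no separate case
      \<open>k = 0\<close>.\<close>
    let ?r = "\<lambda>k b. poly.coeff (?X * R b) k"
    have rec: "(if c = j then poly.coeff p k else 0) = ?r k c - (\<Sum>b<n. ?r (Suc k) b * A $$ (b, c))"
      if c: "c < n" for c k
    proof -
      have "(\<Sum>b<n. R b * char_poly_matrix A $$ (b, c))
          = (\<Sum>b<n. (if b = c then ?X * R b else 0) - Polynomial.smult (A $$ (b, c)) (R b))"
        using c by (intro sum.cong) (auto simp: entry algebra_simps)
      also have "\<dots> = ?X * R c - (\<Sum>b<n. Polynomial.smult (A $$ (b, c)) (R b))"
        using c by (simp add: sum_subtractf)
      finally have "poly.coeff (if c = j then p else 0) k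
          = poly.coeff (?X * R c - (\<Sum>b<n. Polynomial.smult (A $$ (b, c)) (R b))) k"
        unfolding RD[OF c] by simp
      then show ?thesis
        by (cases "c = j") (simp_all add: coeff_sum coeff_monom_mult mult.commute[of "A $$ _"])
    qed
    \<comment> \<open>A bound at least \<open>degree p\<close> and beyond the degree of every
      \<open>R b\<close>; the inserted element keeps the set nonempty when \<open>n = 0\<close> is
      not excluded.\<close>
    define d where "d = Max (insert (degree p) ((\<lambda>b. Suc (degree (R b))) ` {..<n}))"
    have dp: "degree p \<le> d" and dR: "b < n \<Longrightarrow> degree (R b) < d" for b
      unfolding d_def by (auto simp flip: Suc_le_eq intro!: Max_ge)
    let ?f = "\<lambda>k. \<Sum>b<n. ?r k b * (A ^\<^sub>m k) $$ (b, c)"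
    \<comment> \<open>Pairing \<open>rec\<close> with column \<open>c\<close> of
      \<open>A ^ k\<close> lets the factor \<open>A\<close> merge into \<open>A ^ Suc k\<close>, so
      the sum over \<open>k\<close> telescopes.\<close>
    have summand: "poly.coeff p k * (A ^\<^sub>m k) $$ (j, c) = ?f k - ?f (Suc k)" for k
    proof -
      have Ak: "A ^\<^sub>m k \<in> carrier_mat n n" using A by simp
      have "poly.coeff p k * (A ^\<^sub>m k) $$ (j, c)
          = (\<Sum>b<n. (if b = j then poly.coeff p k else 0) * (A ^\<^sub>m k) $$ (b, c))"
        using j by (simp add: if_distrib[of "\<lambda>x. x * _"] cong: if_cong)
      also have "\<dots> = ?f k - (\<Sum>b<n. \<Sum>i<n. ?r (Suc k) i * A $$ (i, b) * (A ^\<^sub>m k) $$ (b, c))"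
        by (simp add: rec left_diff_distrib sum_subtractf sum_distrib_right del: sum.delta sum.delta')
      also have "(\<Sum>b<n. \<Sum>i<n. ?r (Suc k) i * A $$ (i, b) * (A ^\<^sub>m k) $$ (b, c)) = ?f (Suc k)"
        using A Ak c unfolding pow_mat_Suc_left[OF A]
        by (subst sum.swap) (simp add: scalar_prod_def sum_distrib_left atLeast0LessThan mult.assoc)
      finally show ?thesis .
    qed
    have "(\<Sum>k\<le>degree p. poly.coeff p k * (A ^\<^sub>m k) $$ (j, c))
        = (\<Sum>k<Suc d. poly.coeff p k * (A ^\<^sub>m k) $$ (j, c))"
      using dp by (intro sum.mono_neutral_left) (auto simp: coeff_eq_0)
    also have "\<dots> = ?f 0 - ?f (Suc d)"
      unfolding summand by (rule sum_lessThan_telescope')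
    \<comment> \<open>\<open>?f 0\<close> vanishes because \<open>x * R b\<close> has no constant
      term, \<open>?f (Suc d)\<close> because \<open>d\<close> exceeds the degree of
      \<open>R b\<close>.\<close>
    also have "\<dots> = 0"
      using dR by (simp add: coeff_monom_mult coeff_eq_0)
    finally show "(\<Sum>k\<le>degree p. poly.coeff p k * (A ^\<^sub>m k) $$ (j, c)) = 0" .
  qed
qed

theorem proposition2:
  fixes e :: "nat \<Rightarrow> int^'d"
    and q N j :: nat
    and a b dx dt :: real
    and M Minv S :: "real mat"
    and m meq F :: "nat \<Rightarrow> nat \<Rightarrow> real^'d \<Rightarrow> real"
    and Tbar W A B At Ab :: "(int^'d) shift_op mat"
    and \<gamma> :: "nat \<Rightarrow> (int^'d) shift_op"
    and K :: "(nat \<times> (int^'d)) shift_op mat"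
  assumes dim: "CARD('d) \<in> {1, 2, 3}"
    and q: "1 \<le> q"
    and steps: "0 < dx" "0 < dt"
    and ab: "0 < a" "a \<le> 1" "a\<^sup>2 \<le> b" "b \<le> 1"
    and M: "M \<in> carrier_mat q q" "invertible_mat M"
    and Minv: "Minv \<in> carrier_mat q q" "inverts_mat M Minv"
    and S: "S \<in> carrier_mat q q" "invertible_mat S"
    and Tbar: "Tbar = of_real (1 - b) \<cdot>\<^sub>m 1\<^sub>m q
        + of_real ((a + b) / 2) \<cdot>\<^sub>m mat_diag q (\<lambda>i. shift (- e i))
        + of_real ((b - a) / 2) \<cdot>\<^sub>m mat_diag q (\<lambda>i. shift (e i))"
    and W: "W = map_mat of_real M * Tbar * map_mat of_real Minv"
    and A: "A = W * (1\<^sub>m q - map_mat of_real S)"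
    and B: "B = W * map_mat of_real S"
    and N: "1 \<le> N" "N \<le> q"
    and j: "j < N"
    and conserved: "\<And>n l z. l < N \<Longrightarrow> meq n l (lattice_point dx z) = m n l (lattice_point dx z)"
    and model: "\<And>n i z. i < q \<Longrightarrow> m (n + 1) i (lattice_point dx z) =
        mat_app A (level dx m n) i z + mat_app B (level dx meq n) i z
        + dt * mat_app W (level dx F n) i z"
    and At: "At = A * select_mat q ({j} \<union> {N..<q})"
    and Ab: "Ab = A - At"
    and \<gamma>: "\<And>k. 1 \<le> k \<Longrightarrow> k \<le> q + 2 - N \<Longrightarrow> \<gamma> k = poly.coeff (char_poly At) (k + N - 2)"
    and K: "K = time_shift \<cdot>\<^sub>m 1\<^sub>m q - map_mat space_op At"
  shows
    "char_poly At = (\<Sum>k=1..q + 2 - N. Polynomial.monom (\<gamma> k) (k + N - 2)) \<and>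
     (\<forall>n z. q - N \<le> n \<longrightarrow>
       m (n + 1) j (lattice_point dx z) =
         - (\<Sum>k=1..q + 1 - N. app (\<gamma> k) (level dx m (n + N + k - 1 - q) j) z)
         + (\<Sum>k=1..q + 1 - N. \<Sum>l=1..k.
              mat_app (\<gamma> (q + 2 - N + l - k) \<cdot>\<^sub>m (At ^\<^sub>m (l - 1) * Ab)) (level dx m (n + 1 - k)) j z)
         + (\<Sum>k=1..q + 1 - N. \<Sum>l=1..k.
              mat_app (\<gamma> (q + 2 - N + l - k) \<cdot>\<^sub>m At ^\<^sub>m (l - 1))
                (\<lambda>i y. mat_app B (level dx meq (n + 1 - k)) i y
                       + dt * mat_app W (level dx F (n + 1 - k)) i y) j z)) \<and>
     (\<forall>n z.
       app (Determinant.det K) (levels dx m j) (n, z) =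
         mat_app (adj_mat K * map_mat space_op Ab) (levels dx m) j (n, z)
         + mat_app (adj_mat K)
             (\<lambda>i y. mat_app (map_mat space_op B) (levels dx meq) i y
                    + dt * mat_app (map_mat space_op W) (levels dx F) i y) j (n, z))"
proof (intro conjI allI impI)

  \<comment> \<open>Dimensions, vanishing columns and the reduced polynomial\<close>
  have Wc: "W \<in> carrier_mat q q"
    using M Minv unfolding W Tbar by (intro mult_carrier_mat[of _ q q _ q]) auto
  have Ac: "A \<in> carrier_mat q q" and Bc: "B \<in> carrier_mat q q"
    using Wc S unfolding A B by auto
  have Atc: "At \<in> carrier_mat q q"
    using Ac unfolding At by (simp add: select_mat_def)
  have Abc: "Ab \<in> carrier_mat q q"
    using Ac Atc unfolding Ab by (intro minus_carrier_mat)
  have jq: "j < q" using j N by simp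
  let ?Z = "{..<N} - {j}"
  \<comment> \<open>\<open>select_mat\<close> has zero columns at the conserved indices other than
    \<open>j\<close>, and \<open>At\<close> inherits them.\<close>
  have zero: "At $$ (i, c) = 0" if "i < q" "c \<in> ?Z" for i c
  proof -
    have "c < q" using that N by simp
    have "select_mat q ({j} \<union> {N..<q}) $$ (x, c) = (0 :: (int^'d) shift_op)" if "x < q" for x
      using \<open>c \<in> ?Z\<close> \<open>c < q\<close> that jq unfolding select_mat_def by (auto intro!: sum.neutral)
    moreover have "(select_mat q ({j} \<union> {N..<q}) :: (int^'d) shift_op mat) \<in> carrier_mat q q"
      by (simp add: select_mat_def)
    ultimately show ?thesis
      using \<open>i < q\<close> \<open>c < q\<close> Ac unfolding At by (auto simp: scalar_prod_def intro!: sum.neutral)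
  qed
  have Z: "?Z \<subseteq> {..<q}" and cardZ: "card ?Z = N - 1"
    using N j by auto
  obtain p where char: "char_poly At = Polynomial.monom 1 (N - 1) * p"
    and row: "\<And>c. c < q \<Longrightarrow> (\<Sum>k\<le>degree p. poly.coeff p k * (At ^\<^sub>m k) $$ (j, c)) = 0"
  proof (rule char_poly_zero_columns[OF Atc Z zero])
    fix p
    assume "char_poly At = Polynomial.monom 1 (card ?Z) * p"
      and "\<And>j c. j < q \<Longrightarrow> j \<notin> ?Z \<Longrightarrow> c < q \<Longrightarrow>
        (\<Sum>k\<le>degree p. poly.coeff p k * (At ^\<^sub>m k) $$ (j, c)) = 0"
    then show thesis
      using jq by (intro that[of p]) (simp_all only: cardZ, simp)
  qed
  \<comment> \<open>The degree left for \<open>p\<close> after removing \<open>x ^ (N - 1)\<close>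
    from a monic polynomial of degree \<open>q\<close>.\<close>
  define r where "r = q + 1 - N"
  have coeff: "poly.coeff p k = poly.coeff (char_poly At) (k + (N - 1))" for k
    by (simp add: char coeff_monom_mult)
  have monic: "degree (char_poly At) = q" "poly.coeff (char_poly At) q = 1"
    using degree_monic_char_poly[OF Atc] by auto
  have lead: "poly.coeff p r = 1"
    using N monic by (simp add: coeff r_def)
  have deg: "degree p = r"
  proof (rule antisym)
    show "degree p \<le> r"
      using N monic by (intro degree_le) (auto simp: coeff r_def intro: coeff_eq_0)
    show "r \<le> degree p"
      using lead by (intro le_degree) simp
  qed
  \<comment> \<open>The indices of \<open>\<gamma>\<close> start at 1, those of the coefficients of
    \<open>p\<close> at 0.\<close>
  have \<gamma>p: "\<gamma> (Suc k) = poly.coeff p k" if "k \<le> r" for k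
    using \<gamma>[of "Suc k"] that N by (simp add: coeff r_def)

  \<comment> \<open>Expansion of the characteristic polynomial\<close>
  have "(\<Sum>k=1..q + 2 - N. Polynomial.monom (\<gamma> k) (k + N - 2))
      = (\<Sum>i=N - 1..q. Polynomial.monom (poly.coeff (char_poly At) i) i)"
    using N by (intro sum.reindex_bij_witness[where i = "\<lambda>i. i + 2 - N" and j = "\<lambda>k. k + N - 2"])
      (auto simp: \<gamma>)
  \<comment> \<open>The factor \<open>x ^ (N - 1)\<close> kills all coefficients below
    \<open>N - 1\<close>.\<close>
  also have "\<dots> = (\<Sum>i\<le>q. Polynomial.monom (poly.coeff (char_poly At) i) i)"
    by (intro sum.mono_neutral_left) (auto simp: char coeff_monom_mult)
  also have "\<dots> = char_poly At"
    using poly_as_sum_of_monoms[of "char_poly At"] by (simp add: monic)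
  finally show "char_poly At = (\<Sum>k=1..q + 2 - N. Polynomial.monom (\<gamma> k) (k + N - 2))" ..

  \<comment> \<open>The model as a recurrence for \<open>At\<close> with sources\<close>
  define f where "f n i y = mat_app B (level dx meq n) i y + dt * mat_app W (level dx F n) i y"
    for n i y
  define s where "s n i y = mat_app Ab (level dx m n) i y + f n i y" for n i y
  have step: "level dx m (Suc n) i z = mat_app At (level dx m n) i z + s n i z" if "i < q" for n i z
    using model[OF that, of n z] mat_app_minus[OF Ac Atc that]
    by (simp add: level_def s_def f_def Ab)

  \<comment> \<open>The explicit multiple-level scheme\<close>
  {
    fix n :: nat and z :: "int^'d"
    assume n: "q - N \<le> n"
    \<comment> \<open>The oldest level of the scheme; \<open>q - N \<le> n\<close> prevents
      truncation of the subtraction.\<close>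
    define n0 where "n0 = n + N - q"
    have n0: "n0 + r = n + 1" using n N by (simp add: n0_def r_def)
    let ?g = "\<lambda>k l. mat_app (\<gamma> (q + 2 - N + l - k) \<cdot>\<^sub>m At ^\<^sub>m (l - 1)) (s (n + 1 - k)) j z"
    have split: "?g k l
        = mat_app (\<gamma> (q + 2 - N + l - k) \<cdot>\<^sub>m (At ^\<^sub>m (l - 1) * Ab)) (level dx m (n + 1 - k)) j z
        + mat_app (\<gamma> (q + 2 - N + l - k) \<cdot>\<^sub>m At ^\<^sub>m (l - 1)) (f (n + 1 - k)) j z" for k l
    proof -
      let ?P = "At ^\<^sub>m (l - 1)" and ?c = "\<gamma> (q + 2 - N + l - k)"
      have P: "?P \<in> carrier_mat q q" using Atc by simp
      have "?c \<cdot>\<^sub>m (?P * Ab) = (?c \<cdot>\<^sub>m ?P) * Ab"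
        using P Abc by (simp add: mult_smult_assoc_mat)
      moreover have "mat_app ((?c \<cdot>\<^sub>m ?P) * Ab) v j z = mat_app (?c \<cdot>\<^sub>m ?P) (mat_app Ab v) j z" for v
        using P Abc jq by (intro mat_app_mult) auto
      ultimately show ?thesis
        by (simp add: s_def[abs_def] mat_app_add)
    qed
    have "(\<Sum>k\<le>r. app (poly.coeff p k) (level dx m (n0 + k) j) z)
        = (\<Sum>k\<le>r. \<Sum>t<k. mat_app (poly.coeff p k \<cdot>\<^sub>m At ^\<^sub>m (k - 1 - t)) (s (n0 + t)) j z)"
      using row deg
      by (intro annihilated_recurrence[where u = "level dx m" and s = s, OF Atc step jq]) auto
    also have "\<dots> = (\<Sum>(k, t)\<in>(SIGMA k:{..r}. {..<k}).
        mat_app (poly.coeff p k \<cdot>\<^sub>m At ^\<^sub>m (k - 1 - t)) (s (n0 + t)) j z)"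
      by (rule sum.Sigma) auto
    also have "\<dots> = (\<Sum>(k, l)\<in>(SIGMA k:{1..r}. {1..k}). ?g k l)"
    \<comment> \<open>The new first index \<open>r - t\<close> is the age of the source level
      counted from \<open>n + 1\<close>; the new second index \<open>k - t\<close> is one more than
      the power of \<open>At\<close>.\<close>
    proof (rule sum.reindex_bij_witness
        [where i = "\<lambda>(k, l). (r + l - k, r - k)" and j = "\<lambda>(k, t). (r - t, k - t)"])
      fix x assume "x \<in> (SIGMA k:{..r}. {..<k})"
      then obtain k t where x: "x = (k, t)" and kt: "k \<le> r" "t < k" by auto
      have index: "q + 2 - N + (k - t) - (r - t) = Suc k" "n + 1 - (r - t) = n0 + t"
        "k - t - 1 = k - 1 - t"
        using kt n0 N by (auto simp: r_def)
      then show "(case case x of (k, t) \<Rightarrow> (r - t, k - t) of (k, l) \<Rightarrow> ?g k l)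
          = (case x of (k, t) \<Rightarrow> mat_app (poly.coeff p k \<cdot>\<^sub>m At ^\<^sub>m (k - 1 - t)) (s (n0 + t)) j z)"
        using kt by (simp only: x prod.case index \<gamma>p)
    qed auto
    also have "\<dots> = (\<Sum>k=1..r. \<Sum>l=1..k. ?g k l)"
      by (rule sum.Sigma[symmetric]) auto
    finally have rhs: "(\<Sum>k\<le>r. app (poly.coeff p k) (level dx m (n0 + k) j) z)
        = (\<Sum>k=1..r. \<Sum>l=1..k. ?g k l)" .
    \<comment> \<open>The top summand has coefficient 1 and sits at level
      \<open>n0 + r = n + 1\<close>: it is the value to be solved for.\<close>
    have "(\<Sum>k\<le>r. app (poly.coeff p k) (level dx m (n0 + k) j) z)
        = (\<Sum>k<r. app (poly.coeff p k) (level dx m (n0 + k) j) z) + m (n + 1) j (lattice_point dx z)"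
      by (simp add: lead n0 one_shift_op.rep_eq level_def flip: lessThan_Suc_atMost)
    also have "(\<Sum>k<r. app (poly.coeff p k) (level dx m (n0 + k) j) z)
        = (\<Sum>k=1..r. app (\<gamma> k) (level dx m (n + N + k - 1 - q) j) z)"
      unfolding One_nat_def sum.atLeast1_atMost_eq
    proof (rule sum.cong)
      fix k assume "k \<in> {..<r}"
      then show "app (poly.coeff p k) (level dx m (n0 + k) j) z
          = app (\<gamma> (Suc k)) (level dx m (n + N + Suc k - Suc 0 - q) j) z"
        using n N by (simp add: \<gamma>p n0_def)
    qed simp
    finally show "m (n + 1) j (lattice_point dx z) =
         - (\<Sum>k=1..q + 1 - N. app (\<gamma> k) (level dx m (n + N + k - 1 - q) j) z)
         + (\<Sum>k=1..q + 1 - N. \<Sum>l=1..k.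
              mat_app (\<gamma> (q + 2 - N + l - k) \<cdot>\<^sub>m (At ^\<^sub>m (l - 1) * Ab)) (level dx m (n + 1 - k)) j z)
         + (\<Sum>k=1..q + 1 - N. \<Sum>l=1..k.
              mat_app (\<gamma> (q + 2 - N + l - k) \<cdot>\<^sub>m At ^\<^sub>m (l - 1))
                (\<lambda>i y. mat_app B (level dx meq (n + 1 - k)) i y
                       + dt * mat_app W (level dx F (n + 1 - k)) i y) j z)"
      unfolding rhs split sum.distrib f_def[abs_def] r_def[symmetric] by linarith
  }

  \<comment> \<open>The determinant form\<close>
  fix n :: nat and z :: "int^'d"
  let ?src = "\<lambda>i y. mat_app (map_mat space_op B) (levels dx meq) i y
    + dt * mat_app (map_mat space_op W) (levels dx F) i y"
  have Kc: "K \<in> carrier_mat q q" using Atc unfolding K by (intro minus_carrier_mat) simp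
  \<comment> \<open>The recurrence read in space-time: \<open>time_shift\<close> supplies the level
    \<open>n + 1\<close>, and subtracting \<open>At\<close> leaves exactly the sources.\<close>
  have K_apply: "mat_app K (levels dx m) i
      = (\<lambda>y. mat_app (map_mat space_op Ab) (levels dx m) i y + ?src i y)" if i: "i < q" for i
  proof (intro ext, clarify)
    fix n :: nat and z :: "int^'d"
    have "mat_app K (levels dx m) i (n, z)
        = level dx m (Suc n) i z - mat_app At (level dx m n) i z"
      unfolding K using i Atc
      by (subst mat_app_minus[of _ q q])
        (auto simp: mat_app_smult mat_app_one app_time_shift mat_app_space_op levels_def[of dx m i])
    then show "mat_app K (levels dx m) i (n, z)
        = mat_app (map_mat space_op Ab) (levels dx m) i (n, z) + ?src i (n, z)"
      using i Abc Bc Wc by (simp add: step s_def f_def mat_app_space_op)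
  qed
  have adj: "adj_mat K \<in> carrier_mat q q" "adj_mat K * K = Determinant.det K \<cdot>\<^sub>m 1\<^sub>m q"
    using adj_mat[OF Kc] by auto
  have "app (Determinant.det K) (levels dx m j) (n, z)
      = mat_app (adj_mat K * K) (levels dx m) j (n, z)"
    using jq by (simp add: adj mat_app_smult mat_app_one)
  also have "\<dots> = mat_app (adj_mat K) (mat_app K (levels dx m)) j (n, z)"
    using adj Kc jq by (intro mat_app_mult) auto
  also have "\<dots> = mat_app (adj_mat K)
      (\<lambda>i y. mat_app (map_mat space_op Ab) (levels dx m) i y + ?src i y) j (n, z)"
    using adj by (intro mat_app_cong K_apply) auto
  also have "\<dots> = mat_app (adj_mat K * map_mat space_op Ab) (levels dx m) j (n, z)
      + mat_app (adj_mat K) ?src j (n, z)"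
    using adj Abc jq by (simp add: mat_app_add mat_app_mult[of _ q q _ q])
  finally show "app (Determinant.det K) (levels dx m j) (n, z) =
      mat_app (adj_mat K * map_mat space_op Ab) (levels dx m) j (n, z)
      + mat_app (adj_mat K) ?src j (n, z)" .
qed

end
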